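(* Let $G=(V,E)$ be a finite simple directed graph with $n$ nodes and let $V_\ell\subseteq V$ be any set of $m$ leaders. Then $$\delta(G,V_\ell)=n \;\Longrightarrow\; \zeta(G,V_\ell)=n.$$
   Context: Graphs. $G=(V,E)$ is a finite simple directed graph (no self-loops, no multiple edges); $e_{ij}$ denotes an edge from $v_i$ to $v_j$. A node $v_j$ is an in-neighbor of $v_i$ if there is an edge from $v_j$ to $v_i$. The distance $d(u,v)\in\{0,1,2,\dots\}\cup\{\infty\}$ is the number of edges on a shortest directed path from $u$ to $v$, with $d(v,v)=0$ and $d(u,v)=\infty$ if there is no path from $u$ to $v$. Distance-based quantity $\delta(G,V_\ell)$. For a leader set $V_\ell=\{\ell_1,\dots,\ell_m\}\subseteq V$, the distance-to-leaders (DL) vector of a node $v\in V$ is $(d(v,\ell_1),\dots,d(v,\ell_m))$. A finite sequence $(\mathcal D_1,\dots,\mathcal D_k)$ of DL vectors of nodes of $G$ is pseudo-monotonically increasing (PMI) if for every $i$ there exists $\pi(i)\in\{1,\dots,m\}$ such that $[\mathcal D_i]_{\pi(i)}<[\mathcal D_j]_{\pi(i)}$ for all $j>i$ (here every finite number is $<\infty$, and $\infty<\infty$ is false; for the last vector the condition is vacuous). $\delta(G,V_\ell)$ is the length of a longest PMI sequence all of whose members are DL vectors of nodes of $G$ having at least one finite entry. Zero-forcing quantity $\zeta(G,V_\ell)$. Color the nodes of $V_\ell$ black and all other nodes white. Zero forcing rule: if a black node $v$ has exactly one white in-neighbor $u$, then $u$ is recolored black. The rule is applied repeatedly until no further color change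 is possible; the resulting set of black nodes is uniquely determined and is called the derived set $\mathrm{dset}(G,V_\ell)$. Define $\zeta(G,V_\ell)=|\mathrm{dset}(G,V_\ell)|$ (so $\zeta(G,V_\ell)=n$ means that $V_\ell$ is a zero forcing set). *)

theory Defs
  imports "Graph_Theory.Graph_Theory" "HOL-Library.Extended_Nat" "HOL-Library.FuncSet"
begin

text \<open>
  Finite simple directed graphs are the library locale \<^locale>\<open>digraph\<close>. The function \<open>gdist\<close> takes
  values in \<^typ>\<open>enat\<close>; the infimum over the empty set of paths is \<open>\<infinity>\<close>.
\<close>

definition gdist :: "('a, 'b) pre_digraph \<Rightarrow> 'a \<Rightarrow> 'a \<Rightarrow> enat" where
  "gdist G u v = (INF p \<in> {p. pre_digraph.apath G u p v}. enat (length p))"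

text \<open>
  DL vectors are indexed by the leaders themselves instead of by an enumeration
  \<open>l\<^sub>1, \<dots>, l\<^sub>m\<close> of them; being PMI does not depend on the order of the coordinates.
\<close>

definition dl_vector :: "('a, 'b) pre_digraph \<Rightarrow> 'a set \<Rightarrow> 'a \<Rightarrow> ('a \<Rightarrow> enat)" where
  "dl_vector G L v = (\<lambda>l\<in>L. gdist G v l)"

definition pmi :: "'a set \<Rightarrow> ('a \<Rightarrow> enat) list \<Rightarrow> bool" where
  "pmi L Ds \<longleftrightarrow>
     (\<forall>i < length Ds. \<exists>l\<in>L. \<forall>j. i < j \<and> j < length Ds \<longrightarrow> (Ds ! i) l < (Ds ! j) l)"

definition dl_pmi_seqs :: "('a, 'b) pre_digraph \<Rightarrow> 'a set \<Rightarrow> ('a \<Rightarrow> enat) list set" where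
  "dl_pmi_seqs G L =
     {Ds. pmi L Ds \<and>
          (\<forall>D \<in> set Ds. D \<in> dl_vector G L ` verts G \<and> (\<exists>l\<in>L. D l \<noteq> \<infinity>))}"

text \<open>
  The empty sequence is admitted, so the maximum is over a nonempty set (giving 0 if no node
  reaches a leader). That set is finite by lemma \<open>finite_dl_pmi_seqs\<close> below.
\<close>

definition pmi_delta :: "('a, 'b) pre_digraph \<Rightarrow> 'a set \<Rightarrow> nat" where
  "pmi_delta G L = Max (length ` dl_pmi_seqs G L)"

definition in_nbrs :: "('a, 'b) pre_digraph \<Rightarrow> 'a \<Rightarrow> 'a set" where
  "in_nbrs G v = {u. u \<rightarrow>\<^bsub>G\<^esub> v}"

text \<open>One application of the zero forcing rule, on sets of black nodes.\<close>

definition zf_step :: "('a, 'b) pre_digraph \<Rightarrow> 'a set \<Rightarrow> 'a set \<Rightarrow> bool" where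
  "zf_step G B B' \<longleftrightarrow> (\<exists>v\<in>B. \<exists>u. in_nbrs G v - B = {u} \<and> B' = insert u B)"

text \<open>Lemma \<open>dset_ex1\<close> below justifies the description operator.\<close>

definition dset :: "('a, 'b) pre_digraph \<Rightarrow> 'a set \<Rightarrow> 'a set" where
  "dset G L = (THE B. (zf_step G)\<^sup>*\<^sup>* L B \<and> \<not> (\<exists>B'. zf_step G B B'))"

definition zf_zeta :: "('a, 'b) pre_digraph \<Rightarrow> 'a set \<Rightarrow> nat" where
  "zf_zeta G L = card (dset G L)"


text \<open>Agreement with the library's shortest path cost for unit weights.\<close>

lemma (in wf_digraph) gdist_eq_mu: "ereal_of_enat (gdist G u v) = \<mu> (\<lambda>_. 1) u v"
proof -
  have cost: "awalk_cost (\<lambda>_. 1) p = real (length p)" for p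
    by (induction p) auto
  have sub: "\<exists>q. apath u q v \<and> length q \<le> length p" if "awalk u p v" for p
  proof (intro exI conjI)
    show "apath u (awalk_to_apath p) v" using that by (rule apath_awalk_to_apath)
    have "distinct (awalk_to_apath p)"
      using apath_awalk_to_apath[OF that] by (auto simp: apath_def intro: distinct_verts_imp_distinct)
    then show "length (awalk_to_apath p) \<le> length p"
      using awalk_to_apath_subset[OF that]
      by (metis List.finite_set card_length card_mono distinct_card le_trans)
  qed
  show ?thesis
  proof (cases "\<exists>p. apath u p v")
    case False
    then have "{p. awalk u p v} = {}" using sub by blast
    moreover have "{p. apath u p v} = {}" using False by blast
    ultimately show ?thesis
      by (simp add: gdist_def \<mu>_def top_enat_def top_ereal_def)
  next
    case True
    then obtain p where p: "apath u p v" "\<And>q. apath u q v \<Longrightarrow> length p \<le> length q"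
      using arg_min_nat_lemma[of "\<lambda>p. apath u p v" _ length] by blast
    have "gdist G u v = enat (length p)"
      unfolding gdist_def
    proof (rule antisym)
      show "(INF p\<in>{p. apath u p v}. enat (length p)) \<le> enat (length p)"
        using p(1) by (intro INF_lower) simp
    qed (use p(2) in \<open>auto intro: INF_greatest\<close>)
    moreover have "\<mu> (\<lambda>_. 1) u v = ereal (real (length p))"
      unfolding \<mu>_def
    proof (rule antisym)
      have "p \<in> {p. awalk u p v}" using p(1) by (simp add: apath_def)
      from INF_lower[OF this, of "\<lambda>p. ereal (awalk_cost (\<lambda>_. 1) p)"]
      show "(INF p\<in>{p. awalk u p v}. ereal (awalk_cost (\<lambda>_. 1) p)) \<le> ereal (real (length p))"
        by (simp add: cost)
      show "ereal (real (length p)) \<le> (INF p\<in>{p. awalk u p v}. ereal (awalk_cost (\<lambda>_. 1) p))"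
      proof (rule INF_greatest)
        fix q assume "q \<in> {p. awalk u p v}"
        then obtain r where "apath u r v" "length r \<le> length q" using sub by blast
        then have "length p \<le> length q" using p(2) le_trans by blast
        then show "ereal (real (length p)) \<le> ereal (awalk_cost (\<lambda>_. 1) q)"
          by (simp add: cost)
      qed
    qed
    ultimately show ?thesis by simp
  qed
qed

lemma pmi_distinct: "pmi L Ds \<Longrightarrow> distinct Ds"
proof -
  assume P: "pmi L Ds"
  have "Ds ! i \<noteq> Ds ! j" if ij: "i < j" "j < length Ds" for i j
  proof -
    obtain l where "(Ds ! i) l < (Ds ! j) l"
      using P ij less_trans[OF ij] unfolding pmi_def by blast
    then show ?thesis by auto
  qed
  then show "distinct Ds"
    unfolding distinct_conv_nth by (metis linorder_neqE_nat)
qed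

lemma finite_dl_pmi_seqs:
  assumes "finite (verts G)"
  shows "finite (dl_pmi_seqs G L)"
proof (rule finite_subset)
  let ?V = "dl_vector G L ` verts G"
  show "dl_pmi_seqs G L \<subseteq> {Ds. set Ds \<subseteq> ?V \<and> length Ds \<le> card ?V}"
  proof
    fix Ds assume Ds: "Ds \<in> dl_pmi_seqs G L"
    then have sub: "set Ds \<subseteq> ?V" by (auto simp: dl_pmi_seqs_def)
    have "distinct Ds" using Ds by (auto simp: dl_pmi_seqs_def intro: pmi_distinct)
    then have "length Ds \<le> card ?V"
      using sub assms by (metis card_mono distinct_card finite_imageI)
    with sub show "Ds \<in> {Ds. set Ds \<subseteq> ?V \<and> length Ds \<le> card ?V}" by simp
  qed
  show "finite {Ds. set Ds \<subseteq> ?V \<and> length Ds \<le> card ?V}"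
    using assms by (intro finite_lists_length_le) simp
qed

lemma Nil_in_dl_pmi_seqs: "[] \<in> dl_pmi_seqs G L"
  by (simp add: dl_pmi_seqs_def pmi_def)

lemma zf_steps_subset_stable:
  assumes "(zf_step G)\<^sup>*\<^sup>* L B" "L \<subseteq> C" "\<not> (\<exists>C'. zf_step G C C')"
  shows "B \<subseteq> C"
  using assms(1)
proof (induction rule: rtranclp_induct)
  case base
  then show ?case using assms(2) .
next
  case (step B B')
  then obtain v u where vu: "v \<in> B" "in_nbrs G v - B = {u}" "B' = insert u B"
    by (auto simp: zf_step_def)
  have "u \<in> C"
  proof (rule ccontr)
    assume "u \<notin> C"
    then have "in_nbrs G v - C = {u}" using vu(2) step.IH by blast
    then have "zf_step G C (insert u C)"
      using vu(1) step.IH by (auto simp: zf_step_def)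
    then show False using assms(3) by blast
  qed
  then show ?case using vu(3) step.IH by blast
qed

lemma zf_steps_superset: "(zf_step G)\<^sup>*\<^sup>* L B \<Longrightarrow> L \<subseteq> B"
  by (induction rule: rtranclp_induct) (auto simp: zf_step_def)

lemma (in digraph) dset_ex1:
  assumes "L \<subseteq> verts G"
  shows "\<exists>!B. (zf_step G)\<^sup>*\<^sup>* L B \<and> \<not> (\<exists>B'. zf_step G B B')"
proof -
  have "\<exists>B. (zf_step G)\<^sup>*\<^sup>* L B \<and> \<not> (\<exists>B'. zf_step G B B')"
    using assms
  proof (induction "card (verts G - L)" arbitrary: L rule: less_induct)
    case less
    show ?case
    proof (cases "\<exists>B'. zf_step G L B'")
      case True
      then obtain v u where vu: "v \<in> L" "in_nbrs G v - L = {u}" unfolding zf_step_def by blast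
      then have "u \<rightarrow>\<^bsub>G\<^esub> v" "u \<notin> L" unfolding in_nbrs_def by blast+
      then have u: "u \<in> verts G - L" using adj_in_verts by blast
      then have "card (verts G - insert u L) < card (verts G - L)"
        by (intro psubset_card_mono finite_Diff finite_verts) blast
      moreover have "insert u L \<subseteq> verts G" using u less.prems by blast
      ultimately obtain B where
        B: "(zf_step G)\<^sup>*\<^sup>* (insert u L) B" "\<not> (\<exists>B'. zf_step G B B')"
        using less.hyps by blast
      moreover have "zf_step G L (insert u L)" using vu unfolding zf_step_def by blast
      ultimately show ?thesis by (meson converse_rtranclp_into_rtranclp)
    qed blast
  qed
  moreover have "B = C"
    if "(zf_step G)\<^sup>*\<^sup>* L B" "\<not> (\<exists>B'. zf_step G B B')"
       "(zf_step G)\<^sup>*\<^sup>* L C" "\<not> (\<exists>B'. zf_step G C B')" for B C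
    using that zf_steps_subset_stable zf_steps_superset by (metis subset_antisym)
  ultimately show ?thesis by blast
qed

end

theory Submission
  imports Defs
begin

text \<open>
  A PMI sequence of length \<open>n\<close> lists the DL vectors of all nodes, each exactly once, and so orders
  the nodes. In this order, let \<open>v\<close> be a non-leader all of whose predecessors are black, let \<open>l\<close> be
  the leader witnessing the PMI condition at \<open>v\<close>, and let \<open>w\<close> be the next node on a shortest path
  from \<open>v\<close> to \<open>l\<close>. As \<open>w\<close> is closer to \<open>l\<close> than \<open>v\<close>, it precedes \<open>v\<close> and is black; as every
  in-neighbor of \<open>w\<close> is at distance at most \<open>d(v,l)\<close> from \<open>l\<close>, none of them comes after \<open>v\<close>. So \<open>w\<close>
  forces \<open>v\<close>.
\<close>

context wf_digraph
begin

text \<open>\<open>gdist\<close> ranges over paths only, but an arc put in front of a path gives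
  just a walk; cutting out its cycles never lengthens it.\<close>

lemma gdist_le_awalk:
  assumes "awalk u p v"
  shows "gdist G u v \<le> enat (length p)"
proof -
  have path: "apath u (awalk_to_apath p) v"
    using assms by (rule apath_awalk_to_apath)
  then have "distinct (awalk_to_apath p)"
    by (auto simp: apath_def intro: distinct_verts_imp_distinct)
  \<comment> \<open>No arc repeats on the path, so its length is the size of its arc set, which lies
    within that of \<open>p\<close>.\<close>
  then have "length (awalk_to_apath p) \<le> length p"
    using awalk_to_apath_subset[OF assms]
    by (metis List.finite_set card_length card_mono distinct_card le_trans)
  moreover have "gdist G u v \<le> enat (length (awalk_to_apath p))"
    unfolding gdist_def using path by (intro INF_lower) simp
  ultimately show ?thesis
    by (meson enat_ord_simps(1) order_trans)
qed

lemma gdist_finiteE: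
  assumes "gdist G u v \<noteq> \<infinity>"
  obtains p where "apath u p v" "gdist G u v = enat (length p)"
proof -
  let ?A = "(\<lambda>p. enat (length p)) ` {p. apath u p v}"
  have "?A \<noteq> {}"
    using assms unfolding gdist_def by (metis Inf_empty top_enat_def)
  \<comment> \<open>On a nonempty set, \<open>Inf\<close> in \<open>enat\<close> is a least element,
    hence attained.\<close>
  then have "Inf ?A \<in> ?A"
    unfolding Inf_enat_def by (auto intro: LeastI)
  then show thesis
    using that unfolding gdist_def by auto
qed

lemma gdist_adj_le:
  assumes "u \<rightarrow> w"
  shows "gdist G u v \<le> gdist G w v + 1"
proof (cases "gdist G w v = \<infinity>")
  case False
  then obtain p where p: "apath w p v" "gdist G w v = enat (length p)"
    by (rule gdist_finiteE)
  obtain e where "arc e (u, w)"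
    using assms by (auto simp: arcs_ends_def arc_to_ends_def arc_def)
  then have "awalk u (e # p) v"
    using p(1) by (auto simp: apath_def awalk_Cons_iff arc_def)
  from gdist_le_awalk[OF this] show ?thesis
    by (simp add: p(2) one_enat_def)
qed simp

lemma gdist_closer_neighbor:
  assumes "gdist G u v \<noteq> \<infinity>" "u \<noteq> v"
  obtains w where "u \<rightarrow> w" "gdist G u v = gdist G w v + 1" "gdist G w v < gdist G u v"
proof -
  obtain p where p: "apath u p v" "gdist G u v = enat (length p)"
    using assms(1) by (rule gdist_finiteE)
  then obtain e q where q: "p = e # q"
    using assms(2) by (cases p) (auto simp: apath_Nil_iff)
  let ?w = "head G e"
  have adj: "u \<rightarrow> ?w" and walk: "awalk ?w q v"
    using p(1) unfolding q by (auto simp: apath_def awalk_Cons_iff intro: in_arcs_imp_in_arcs_ends)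
  have le: "gdist G ?w v \<le> enat (length q)"
    using walk by (rule gdist_le_awalk)
  then obtain k where k: "gdist G ?w v = enat k" "k \<le> length q"
    by (cases "gdist G ?w v") auto
  \<comment> \<open>Going through \<open>?w\<close> cannot beat the shortest path \<open>p\<close>,
    so its tail \<open>q\<close> is shortest as well.\<close>
  moreover have "enat (length p) \<le> gdist G ?w v + 1"
    using gdist_adj_le[OF adj, of v] p(2) by simp
  ultimately have "k = length q"
    by (simp add: q one_enat_def)
  then show thesis
    using that[OF adj] p(2) k(1) by (simp add: q one_enat_def)
qed

end

lemma in_nbrs_subset_verts: "wf_digraph G \<Longrightarrow> in_nbrs G v \<subseteq> verts G"
  unfolding in_nbrs_def using wf_digraph.adj_in_verts(1) by fastforce

lemma (in digraph) dset_props: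
  assumes "L \<subseteq> verts G"
  shows "L \<subseteq> dset G L" "dset G L \<subseteq> verts G" "\<not> (\<exists>B. zf_step G (dset G L) B)"
proof -
  have *: "(zf_step G)\<^sup>*\<^sup>* L (dset G L) \<and> \<not> (\<exists>B. zf_step G (dset G L) B)"
    unfolding dset_def by (rule theI'[OF dset_ex1[OF assms]])
  then show "L \<subseteq> dset G L" "\<not> (\<exists>B. zf_step G (dset G L) B)"
    using zf_steps_superset by blast+
  \<comment> \<open>The full vertex set is stable, so forcing from \<open>L\<close> never leaves
    it.\<close>
  have "\<not> (\<exists>B. zf_step G (verts G) B)"
    using in_nbrs_subset_verts[OF wf_digraph_axioms] unfolding zf_step_def by blast
  with * show "dset G L \<subseteq> verts G"
    using zf_steps_subset_stable assms by blast
qed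

lemma pmi_delta_attained:
  assumes "finite (verts G)"
  obtains Ds where "Ds \<in> dl_pmi_seqs G L" "length Ds = pmi_delta G L"
proof -
  have "pmi_delta G L \<in> length ` dl_pmi_seqs G L"
    unfolding pmi_delta_def
    using finite_dl_pmi_seqs[OF assms, of L] Nil_in_dl_pmi_seqs[of G L] by (intro Max_in) auto
  then show thesis
    using that by auto
qed

text \<open>Pigeonhole: PMI sequences have no repetitions, and there are at most
  \<open>card (verts G)\<close> DL vectors.\<close>

lemma full_dl_pmi_seq:
  assumes "finite (verts G)" "Ds \<in> dl_pmi_seqs G L" "length Ds = card (verts G)"
  shows "set Ds = dl_vector G L ` verts G" "inj_on (dl_vector G L) (verts G)"
proof -
  let ?V = "dl_vector G L ` verts G"
  have sub: "set Ds \<subseteq> ?V" and "distinct Ds"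
    using assms(2) by (auto simp: dl_pmi_seqs_def intro: pmi_distinct)
  then have card: "card (set Ds) = card (verts G)"
    using assms(3) distinct_card by metis
  have le: "card ?V \<le> card (verts G)"
    using assms(1) by (rule card_image_le)
  show eq: "set Ds = ?V"
    using assms(1) sub card le by (intro card_seteq) auto
  show "inj_on (dl_vector G L) (verts G)"
    using assms(1) card by (intro eq_card_imp_inj_on) (simp_all add: eq)
qed

text \<open>The PMI condition says nothing at the last index; there, finiteness comes from membership.\<close>

lemma dl_pmi_seq_leader:
  assumes "Ds \<in> dl_pmi_seqs G L" "i < length Ds"
  obtains l where "l \<in> L" "(Ds ! i) l \<noteq> \<infinity>"
    "\<And>j. i < j \<Longrightarrow> j < length Ds \<Longrightarrow> (Ds ! i) l < (Ds ! j) l"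
proof (cases "Suc i < length Ds")
  case True
  obtain l where l: "l \<in> L" "\<And>j. i < j \<Longrightarrow> j < length Ds \<Longrightarrow> (Ds ! i) l < (Ds ! j) l"
    using assms unfolding dl_pmi_seqs_def pmi_def by blast
  \<comment> \<open>The value lies strictly below the one at \<open>Suc i\<close>, hence is
    finite.\<close>
  then have "(Ds ! i) l \<noteq> \<infinity>"
    using True by (metis enat_ord_code(6) lessI)
  with l that show thesis by blast
next
  case False
  have "Ds ! i \<in> set Ds"
    using assms(2) by simp
  then obtain l where "l \<in> L" "(Ds ! i) l \<noteq> \<infinity>"
    using assms(1) unfolding dl_pmi_seqs_def by blast
  with that False show thesis by fastforce
qed

text \<open>No forcing run is traced: the first node of the order outside \<open>C\<close> could be
  forced, contradicting stability.\<close>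

lemma (in wf_digraph) stable_superset_of_full_dl_pmi_seq:
  assumes Ds: "Ds \<in> dl_pmi_seqs G L"
    and full: "set Ds = dl_vector G L ` verts G" "inj_on (dl_vector G L) (verts G)"
    and C: "L \<subseteq> C" "\<not> (\<exists>B. zf_step G C B)"
  shows "verts G \<subseteq> C"
proof -
  have index: "\<exists>i<length Ds. dl_vector G L v = Ds ! i" if "v \<in> verts G" for v
    using that full(1) by (metis imageI in_set_conv_nth)
  have "v \<in> C" if "v \<in> verts G" "i < length Ds" "dl_vector G L v = Ds ! i" for v i
    using that
  proof (induction i arbitrary: v rule: less_induct)
    case (less i)
    obtain l where l: "l \<in> L" "(Ds ! i) l \<noteq> \<infinity>"
      and later: "\<And>j. i < j \<Longrightarrow> j < length Ds \<Longrightarrow> (Ds ! i) l < (Ds ! j) l"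
      using dl_pmi_seq_leader[OF Ds less.prems(2)] by blast
    have dist: "gdist G u l = (Ds ! j) l" if "dl_vector G L u = Ds ! j" for u j
      using that[symmetric] l(1) by (simp add: dl_vector_def)
    show ?case
    proof (rule ccontr)
      assume v: "v \<notin> C"
      have "gdist G v l \<noteq> \<infinity>" "v \<noteq> l"
        using dist[OF less.prems(3)] l v C(1) by auto
      then obtain w where w: "v \<rightarrow> w" "gdist G v l = gdist G w l + 1" "gdist G w l < gdist G v l"
        by (rule gdist_closer_neighbor)
      \<comment> \<open>Positions after \<open>i\<close> are strictly farther from \<open>l\<close>.
        Those before \<open>i\<close> are black by induction, and by injectivity only
        \<open>v\<close> sits at \<open>i\<close>.\<close>
      have earlier: "u \<in> C \<or> u = v" if u: "u \<in> verts G" "gdist G u l \<le> gdist G v l" for u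
      proof -
        obtain j where j: "j < length Ds" "dl_vector G L u = Ds ! j"
          using index u(1) by blast
        have "j \<le> i"
          using later[of j] j u(2) dist[OF j(2)] dist[OF less.prems(3)] by fastforce
        then consider "j < i" | "j = i" by linarith
        then show ?thesis
        proof cases
          case 1
          then show ?thesis using less.IH j u(1) by blast
        next
          case 2
          then show ?thesis using full(2) j less.prems u(1) by (metis inj_onD)
        qed
      qed
      have "w \<in> verts G"
        using w(1) by (rule adj_in_verts(2))
      \<comment> \<open>The strict inequality rules out \<open>w = v\<close>.\<close>
      then have "w \<in> C"
        using earlier w(3) by fastforce
      moreover have "in_nbrs G w - C = {v}"
      proof -
        \<comment> \<open>An in-neighbor of \<open>w\<close> is at distance at most d(w,l) + 1 =
          d(v,l) from \<open>l\<close>.\<close>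
        have "u \<in> C \<or> u = v" if "u \<rightarrow> w" for u
          using gdist_adj_le[OF that, of l] w(2) that by (intro earlier) (auto simp: adj_in_verts)
        then show ?thesis
          using w(1) v unfolding in_nbrs_def by auto
      qed
      ultimately show False
        using C(2) unfolding zf_step_def by blast
    qed
  qed
  then show ?thesis
    using index by blast
qed

theorem theorem3p4:
  fixes G :: "('a, 'b) pre_digraph" and L :: "'a set" and n m :: nat
  assumes "digraph G"
    and "card (verts G) = n"
    and "L \<subseteq> verts G"
    and "card L = m"
  shows "pmi_delta G L = n \<longrightarrow> zf_zeta G L = n"
proof
  assume delta: "pmi_delta G L = n"
  interpret digraph G by fact
  obtain Ds where Ds: "Ds \<in> dl_pmi_seqs G L" "length Ds = card (verts G)"
    using pmi_delta_attained[OF finite_verts, of L] delta assms(2) by metis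
  have "verts G \<subseteq> dset G L"
    using Ds(1) full_dl_pmi_seq[OF finite_verts Ds] dset_props(1,3)[OF assms(3)]
    by (rule stable_superset_of_full_dl_pmi_seq)
  then have "dset G L = verts G"
    using dset_props(2)[OF assms(3)] by blast
  then show "zf_zeta G L = n"
    by (simp add: zf_zeta_def assms(2))
qed

end
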